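(* There exists an absolute constant $C<\infty$ (independent of $n$ and $o$) such that for every $n\ge 3$ and every vertex $o$ of the cycle $C_n$, the pile process on $C_n$ started from $\eta_0=n\delta_o$ satisfies $$\mathbb E_o\,\tau_n\le C n^3,$$ where $\tau_n$ is the hitting time of the configuration with height one at every vertex.
   Context: The pile process on a finite connected graph $G=(V,E)$ is the following discrete-time Markov chain. A state is a function $\eta:V\to\{0,1,2,\dots\}$; $\eta(x)$ is the number of particles (the height) at $x$. Write $F(\eta)=\{x\in V:\exists y\sim x,\ \eta(y)<\eta(x)\}$ (the free vertices), and for $x\in F(\eta)$ let $M_x(\eta)=\{y\sim x:\eta(y)=\min_{z\sim x}\eta(z)\}$. Let $S(\eta)=\sum_{z\in F(\eta)}\eta(z)$. If $F(\eta)=\emptyset$ the chain stays at $\eta$. Otherwise the transition probabilities are $$P(\eta,\eta-\delta_x+\delta_y)=\frac{\eta(x)}{S(\eta)}\cdot\frac1{|M_x(\eta)|},\qquad x\in F(\eta),\ y\in M_x(\eta),$$ and all other transition probabilities are zero. (That is, a particle is chosen uniformly among all particles at free vertices and moves to a uniformly chosen minimum-height neighbor.) Here $G=C_n$ is the cycle with $n$ vertices, and the initial state $n\delta_o$ has $n$ particles at $o$ and none elsewhere. The state with height one at every vertex is the unique absorbing state with $n$ particles, and $\tau_n$ is its hitting time. $\mathbb E_o$ is expectation for the chain started at $n\delta_o$. *)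

theory Defs
  imports "HOL-Probability.Probability"
begin

text \<open>The law on trajectories of the chain that starts at \<open>s\<close> and moves by the kernel \<open>K\<close>,
  obtained from the Ionescu-Tulcea theorem of the library. Every coordinate space carries the
  discrete sigma-algebra; the coordinate \<open>\<omega> k\<close> is the state at time \<open>k\<close>.\<close>

definition chain_kernel :: "('s \<Rightarrow> 's pmf) \<Rightarrow> 's \<Rightarrow> nat \<Rightarrow> (nat \<Rightarrow> 's) \<Rightarrow> 's measure" where
  "chain_kernel K s i \<omega> =
     (case i of 0 \<Rightarrow> measure_pmf (return_pmf s) | Suc j \<Rightarrow> measure_pmf (K (\<omega> j)))"

definition chain_measure :: "('s \<Rightarrow> 's pmf) \<Rightarrow> 's \<Rightarrow> (nat \<Rightarrow> 's) measure" where
  "chain_measure K s =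
     projective_family.lim UNIV
       (Ionescu_Tulcea.CI (chain_kernel K s) (\<lambda>_. count_space UNIV)) (\<lambda>_. count_space UNIV)"

lemma Ionescu_Tulcea_chain: "Ionescu_Tulcea (chain_kernel K s) (\<lambda>_. count_space UNIV)"
proof (rule Ionescu_Tulcea.intro)
  show "chain_kernel K s i
      \<in> measurable (PiM {0..<i} (\<lambda>_. count_space UNIV)) (subprob_algebra (count_space UNIV))" for i
  proof (cases i)
    case 0
    then show ?thesis
      by (auto simp: chain_kernel_def[abs_def] space_subprob_algebra
          measure_pmf.subprob_space_axioms)
  next
    case (Suc j)
    have "(\<lambda>\<omega>. \<omega> j) \<in> measurable (PiM {0..<i} (\<lambda>_. count_space UNIV)) (count_space UNIV)"
      using Suc by (intro measurable_component_singleton) auto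
    moreover have "(\<lambda>x. measure_pmf (K x))
        \<in> measurable (count_space UNIV) (subprob_algebra (count_space UNIV))"
      by (auto simp: space_subprob_algebra measure_pmf.subprob_space_axioms)
    ultimately have "(\<lambda>\<omega>. measure_pmf (K (\<omega> j)))
        \<in> measurable (PiM {0..<i} (\<lambda>_. count_space UNIV)) (subprob_algebra (count_space UNIV))"
      by (rule measurable_compose)
    with Suc show ?thesis
      by (simp add: chain_kernel_def[abs_def])
  qed
  show "prob_space (chain_kernel K s i x)"
    if "x \<in> space (PiM {0..<i} (\<lambda>_. count_space UNIV))" for i x
    by (auto simp: chain_kernel_def measure_pmf.prob_space_axioms split: nat.split)
qed

lemma prob_space_chain_measure: "prob_space (chain_measure K s)"
proof -
  interpret Ionescu_Tulcea "chain_kernel K s" "\<lambda>_. count_space UNIV"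
    by (rule Ionescu_Tulcea_chain)
  have "emeasure PF.lim (PF.emb UNIV {} (space (PiM {} (\<lambda>_. count_space UNIV))))
      = emeasure (CI {}) (space (PiM {} (\<lambda>_. count_space UNIV)))"
    by (rule lim) auto
  also have "\<dots> = 1"
    using prob_space.emeasure_space_1[OF PF.prob_space_P, of "{}"]
    by (simp add: CI_def)
  finally show ?thesis
    unfolding chain_measure_def
    by (intro prob_spaceI) (simp add: prod_emb_def space_PiM vimage_def restrict_def)
qed

lemma sets_chain_measure [measurable_cong]:
  "sets (chain_measure K s) = sets (PiM UNIV (\<lambda>_. count_space UNIV))"
proof -
  interpret Ionescu_Tulcea "chain_kernel K s" "\<lambda>_. count_space UNIV"
    by (rule Ionescu_Tulcea_chain)
  show ?thesis unfolding chain_measure_def by simp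
qed

lemma emeasure_chain_measure_cylinder:
  "emeasure (chain_measure K s) {\<omega>. \<forall>i\<le>k. \<omega> i = x i}
     = (if x 0 = s then \<Prod>i<k. ennreal (pmf (K (x i)) (x (Suc i))) else 0)"
proof -
  interpret Ionescu_Tulcea "chain_kernel K s" "\<lambda>_. count_space UNIV"
    by (rule Ionescu_Tulcea_chain)
  define A where "A n = PiE {0..<n} (\<lambda>i. {x i})" for n
  have A[measurable]: "A n \<in> sets (PiM {0..<n} (\<lambda>_. count_space UNIV))" for n
    unfolding A_def by (intro sets_PiM_I_finite) auto
  define w where "w n = emeasure (chain_kernel K s n x) {x n}" for n
  have C: "emeasure (C 0 n (\<lambda>_. undefined)) (A n) = (\<Prod>i<n. w i)" for n
  proof (induction n)
    case 0
    have "(\<lambda>_. undefined) \<in> A 0" by (simp add: A_def)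
    then show ?case using A[of 0] by (simp add: A_def emeasure_return)
  next
    case (Suc n)
    have "emeasure (C 0 (Suc n) (\<lambda>_. undefined)) (A (Suc n))
        = (\<integral>\<^sup>+\<omega>. emeasure (eP n \<omega>) (A (Suc n)) \<partial>C 0 n (\<lambda>_. undefined))"
      using measurable_eP[of n] sets_C[of "\<lambda>_. undefined" 0 n] space_C[of "\<lambda>_. undefined" 0 n]
      by (simp, subst emeasure_bind[where N="PiM {0..<Suc n} (\<lambda>_. count_space UNIV)"])
         (auto cong: measurable_cong_sets)
    also have "\<dots> = (\<integral>\<^sup>+\<omega>. w n * indicator (A n) \<omega> \<partial>C 0 n (\<lambda>_. undefined))"
    proof (rule nn_integral_cong)
      fix \<omega> assume "\<omega> \<in> space (C 0 n (\<lambda>_. undefined))"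
      then have \<omega>: "\<omega> \<in> space (PiM {0..<n} (\<lambda>_. count_space UNIV))"
        using space_C[of "\<lambda>_. undefined" 0 n] by simp
      have upd: "fun_upd \<omega> n y \<in> A (Suc n) \<longleftrightarrow> \<omega> \<in> A n \<and> y = x n" for y
        using \<omega> by (auto simp: A_def PiE_iff space_PiM extensional_def less_Suc_eq)
      have eq: "chain_kernel K s n \<omega> = chain_kernel K s n x" if "\<omega> \<in> A n"
        using that by (auto simp: chain_kernel_def A_def PiE_iff split: nat.split)
      show "emeasure (eP n \<omega>) (A (Suc n)) = w n * indicator (A n) \<omega>"
        using eq by (subst emeasure_eP[OF \<omega> A]) (auto simp: upd vimage_def w_def split: split_indicator)
    qed
    also have "\<dots> = w n * (\<Prod>i<n. w i)"
      using Suc.IH A[of n] sets_C[of "\<lambda>_. undefined" 0 n]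
      by (subst nn_integral_cmult_indicator) auto
    finally show ?case by (simp add: mult.commute)
  qed
  have "{\<omega>. \<forall>i\<le>k. \<omega> i = x i} = PF.emb UNIV {0..<Suc k} (A (Suc k))"
    by (auto simp: prod_emb_def A_def space_PiM less_Suc_eq_le PiE_iff)
  then have "emeasure (chain_measure K s) {\<omega>. \<forall>i\<le>k. \<omega> i = x i} = (\<Prod>i<Suc k. w i)"
    unfolding chain_measure_def
    using lim[of "{0..<Suc k}" "A (Suc k)"] emeasure_CI[of "{0..<Suc k}" "Suc k" "A (Suc k)"]
      C[of "Suc k"] sets.sets_into_space[OF A, of "Suc k"]
    by (simp add: prod_emb_id space_PiM del: C.simps)
  also have "\<dots> = w 0 * (\<Prod>i<k. w (Suc i))"
    by (rule prod.lessThan_Suc_shift)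
  also have "\<dots> = (if x 0 = s then \<Prod>i<k. ennreal (pmf (K (x i)) (x (Suc i))) else 0)"
    by (simp add: w_def chain_kernel_def emeasure_pmf_single)
  finally show ?thesis .
qed

definition hitting_time :: "'s set \<Rightarrow> (nat \<Rightarrow> 's) \<Rightarrow> enat" where
  "hitting_time A \<omega> = (INF k\<in>{k. \<omega> k \<in> A}. enat k)"

text \<open>A graph is given by its vertex set \<open>V\<close> and its adjacency relation \<open>adj\<close>. A configuration is a
  total function on the vertex type, of which only the values on \<open>V\<close> matter.\<close>

definition nbrs :: "'v set \<Rightarrow> ('v \<Rightarrow> 'v \<Rightarrow> bool) \<Rightarrow> 'v \<Rightarrow> 'v set" where
  "nbrs V adj x = {y \<in> V. adj x y}"

definition free_verts :: "'v set \<Rightarrow> ('v \<Rightarrow> 'v \<Rightarrow> bool) \<Rightarrow> ('v \<Rightarrow> nat) \<Rightarrow> 'v set" where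
  "free_verts V adj \<eta> = {x \<in> V. \<exists>y\<in>nbrs V adj x. \<eta> y < \<eta> x}"

definition min_nbrs :: "'v set \<Rightarrow> ('v \<Rightarrow> 'v \<Rightarrow> bool) \<Rightarrow> ('v \<Rightarrow> nat) \<Rightarrow> 'v \<Rightarrow> 'v set" where
  "min_nbrs V adj \<eta> x = {y \<in> nbrs V adj x. \<eta> y = Min (\<eta> ` nbrs V adj x)}"

definition free_mass :: "'v set \<Rightarrow> ('v \<Rightarrow> 'v \<Rightarrow> bool) \<Rightarrow> ('v \<Rightarrow> nat) \<Rightarrow> nat" where
  "free_mass V adj \<eta> = (\<Sum>z\<in>free_verts V adj \<eta>. \<eta> z)"

text \<open>Truncated subtraction is harmless below: a free vertex has height at least one.\<close>

definition move :: "('v \<Rightarrow> nat) \<Rightarrow> 'v \<Rightarrow> 'v \<Rightarrow> ('v \<Rightarrow> nat)" where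
  "move \<eta> x y = (\<lambda>z. \<eta> z - of_bool (z = x) + of_bool (z = y))"

text \<open>For a loopless graph the pair \<open>(x, y)\<close> is determined by \<open>move \<eta> x y\<close>, so that at most one
  term of the double sum is nonzero.\<close>

definition pile_prob :: "'v set \<Rightarrow> ('v \<Rightarrow> 'v \<Rightarrow> bool) \<Rightarrow> ('v \<Rightarrow> nat) \<Rightarrow> ('v \<Rightarrow> nat) \<Rightarrow> real" where
  "pile_prob V adj \<eta> \<eta>' =
     (if free_verts V adj \<eta> = {} then of_bool (\<eta>' = \<eta>)
      else \<Sum>x\<in>free_verts V adj \<eta>. \<Sum>y\<in>min_nbrs V adj \<eta> x.
        if \<eta>' = move \<eta> x y
        then real (\<eta> x) / real (free_mass V adj \<eta>) * (1 / real (card (min_nbrs V adj \<eta> x)))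
        else 0)"

definition pile_step :: "'v set \<Rightarrow> ('v \<Rightarrow> 'v \<Rightarrow> bool) \<Rightarrow> ('v \<Rightarrow> nat) \<Rightarrow> ('v \<Rightarrow> nat) pmf" where
  "pile_step V adj \<eta> = embed_pmf (pile_prob V adj \<eta>)"

lemma pmf_pile_step:
  assumes "finite V"
  shows "pmf (pile_step V adj \<eta>) \<eta>' = pile_prob V adj \<eta> \<eta>'"
  unfolding pile_step_def
proof (rule pmf_embed_pmf)
  let ?F = "free_verts V adj \<eta>" and ?M = "min_nbrs V adj \<eta>" and ?S = "free_mass V adj \<eta>"
  show "0 \<le> pile_prob V adj \<eta> \<zeta>" for \<zeta>
    by (auto simp: pile_prob_def intro!: sum_nonneg split: if_splits)
  have fin: "finite ?F" "\<And>x. finite (nbrs V adj x)" "\<And>x. finite (?M x)"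
    using assms by (auto simp: free_verts_def min_nbrs_def nbrs_def)
  have M: "?M x \<noteq> {}" if "x \<in> ?F" for x
  proof -
    have "nbrs V adj x \<noteq> {}" using that by (auto simp: free_verts_def)
    then have "Min (\<eta> ` nbrs V adj x) \<in> \<eta> ` nbrs V adj x"
      using fin by (intro Min_in) auto
    then show ?thesis by (auto simp: min_nbrs_def)
  qed
  show "(\<integral>\<^sup>+\<zeta>. ennreal (pile_prob V adj \<eta> \<zeta>) \<partial>count_space UNIV) = 1"
  proof (cases "?F = {}")
    case True
    then have "ennreal (pile_prob V adj \<eta> \<zeta>) = indicator {\<eta>} \<zeta>" for \<zeta>
      by (auto simp: pile_prob_def split: split_indicator)
    then show ?thesis by simp
  next
    case False
    define p where "p x = real (\<eta> x) / real ?S * (1 / real (card (?M x)))" for x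
    have p: "p x \<ge> 0" for x by (simp add: p_def)
    from False obtain x0 where x0: "x0 \<in> ?F" by auto
    then have "0 < \<eta> x0" by (auto simp: free_verts_def)
    then have S: "?S > 0"
      unfolding free_mass_def using fin x0 by (intro sum_pos2[of _ x0]) auto
    have "ennreal (pile_prob V adj \<eta> \<zeta>)
        = (\<Sum>x\<in>?F. \<Sum>y\<in>?M x. ennreal (p x) * indicator {move \<eta> x y} \<zeta>)" for \<zeta>
    proof -
      have "pile_prob V adj \<eta> \<zeta> = (\<Sum>x\<in>?F. \<Sum>y\<in>?M x. p x * indicator {move \<eta> x y} \<zeta>)"
        unfolding pile_prob_def p_def using False
        by (auto intro!: sum.cong split: if_splits split_indicator)
      then show ?thesis
        using p by (simp add: sum_nonneg ennreal_mult ennreal_indicator flip: sum_ennreal)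
    qed
    then have "(\<integral>\<^sup>+\<zeta>. ennreal (pile_prob V adj \<eta> \<zeta>) \<partial>count_space UNIV)
        = (\<Sum>x\<in>?F. \<Sum>y\<in>?M x. ennreal (p x))"
      by (simp add: nn_integral_sum nn_integral_cmult)
    also have "\<dots> = ennreal (\<Sum>x\<in>?F. \<Sum>y\<in>?M x. p x)"
      using p by (simp add: sum_nonneg ennreal_mult flip: sum_ennreal ennreal_of_nat_eq_real_of_nat)
    also have "(\<Sum>x\<in>?F. \<Sum>y\<in>?M x. p x) = (\<Sum>x\<in>?F. real (\<eta> x) / real ?S)"
      using M fin by (auto simp: p_def intro!: sum.cong)
    also have "\<dots> = 1"
      using S by (simp add: free_mass_def del: of_nat_sum flip: sum_divide_distrib of_nat_sum)
    finally show ?thesis by simp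
  qed
qed

definition pile_process ::
  "'v set \<Rightarrow> ('v \<Rightarrow> 'v \<Rightarrow> bool) \<Rightarrow> ('v \<Rightarrow> nat) \<Rightarrow> (nat \<Rightarrow> ('v \<Rightarrow> nat)) measure" where
  "pile_process V adj \<eta>\<^sub>0 = chain_measure (pile_step V adj) \<eta>\<^sub>0"

definition flat_time :: "'v set \<Rightarrow> (nat \<Rightarrow> ('v \<Rightarrow> nat)) \<Rightarrow> enat" where
  "flat_time V = hitting_time {\<eta>. \<forall>v\<in>V. \<eta> v = 1}"

definition pile_at :: "nat \<Rightarrow> 'v \<Rightarrow> ('v \<Rightarrow> nat)" where
  "pile_at n r = (\<lambda>v. if v = r then n else 0)"

definition cycle_verts :: "nat \<Rightarrow> nat set" where
  "cycle_verts n = {..<n}"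

definition cycle_adj :: "nat \<Rightarrow> nat \<Rightarrow> nat \<Rightarrow> bool" where
  "cycle_adj n u v \<longleftrightarrow> u < n \<and> v < n \<and> (v = (u + 1) mod n \<or> u = (v + 1) mod n)"

end

theory Submission
  imports Defs
begin

text \<open>The proof exhibits a Lyapunov function of order \<open>n^3\<close> at the start that decreases by at least 1 per
step on average as long as the state is not flat.

Let \<open>W\<close> be the height function of the state: its increment from the predecessor of \<open>x\<close> to \<open>x\<close> is \<open>\<eta> x - 1\<close>.
A jump to the right lowers \<open>W\<close> by one at one vertex, and a jump to the left raises it by one
at one vertex. The first part of the Lyapunov function is the pair gap \<open>\<Sum>x y. \<bar>W x - W y\<bar>\<close>, which
equals \<open>2 \<Sum>j. m j (n - m j)\<close> where \<open>m j\<close> counts the vertices with \<open>W \<ge> j\<close>. As \<open>m (n - m)\<close> is concave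
with second difference \<open>-2\<close>, every jump changes the pair gap by \<open>-2\<close> plus a first-order term, namely
\<open>\<plusminus> 2 (n - 2 m j)\<close> at the level \<open>j\<close> concerned. For a single pair of a surplus particle and a hole at
distance \<open>L\<close>, the pair gap is \<open>2 L (n - L)\<close>, and \<open>L\<close> performs a fair random walk until the two are close.

In general the first-order terms do not cancel, but if all falls were by a single level, their sum,
weighted with the jump rates, would not be positive. For falls from heights \<open>b \<ge> 2\<close> the reason is that every arc
of vertices of height at least \<open>b\<close> emits particles at the same rate at both ends, and \<open>W\<close> is higher
at the right end; for falls from height 1 it is that a hole is pushed equally from both sides, up to a
deficit at close pairs of holes that has the right sign. These are \<open>sum_level_current_le\<close> and
\<open>sum_hole_current_nonpos\<close>. Falls by \<open>d \<ge> 2\<close> levels spoil the balance by at most a multiple of \<open>n (d - 1)\<close> each.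
They are paid for by the second part of the Lyapunov function, \<open>6 n \<Sum>x. (\<eta> x)^2\<close>, which decreases
by \<open>12 n (d - 1)\<close> at a fall by \<open>d\<close> levels. The estimate \<open>vertex_current_le\<close> compares the actual currents
with the balanced ones, and \<open>energy_drift\<close> concludes that the drift is at most \<open>-2\<close>.

Both parts are \<open>O(n^3)\<close> for \<open>n\<close> particles at one vertex, so the expected hitting time is at most
\<open>7 n^3\<close> by \<open>expected_hitting_time_le_Lyapunov\<close>.\<close>

section \<open>Expected hitting times and Lyapunov functions\<close>

text \<open>A hitting time counts the steps survived so far; its expectation is thereby a sum of survival
  probabilities, each of which depends on finitely many coordinates only.\<close>

lemma ennreal_of_enat_hitting_time:
  "ennreal_of_enat (hitting_time A \<omega>) = (\<Sum>k. indicator {\<omega>. \<forall>i\<le>k. \<omega> i \<notin> A} \<omega>)"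
proof (cases "\<exists>k. \<omega> k \<in> A")
  case True
  define m where "m = (LEAST k. \<omega> k \<in> A)"
  have m: "\<omega> m \<in> A" "\<And>k. \<omega> k \<in> A \<Longrightarrow> m \<le> k"
    using LeastI_ex[OF True] Least_le[of "\<lambda>k. \<omega> k \<in> A"] by (auto simp: m_def)
  have "hitting_time A \<omega> = enat m"
    unfolding hitting_time_def using m by (intro antisym INF_lower INF_greatest) auto
  moreover have "(\<Sum>k. indicator {\<omega>. \<forall>i\<le>k. \<omega> i \<notin> A} \<omega>) = (\<Sum>k<m. (1::ennreal))"
  proof -
    have "(\<Sum>k. indicator {\<omega>. \<forall>i\<le>k. \<omega> i \<notin> A} \<omega>)
        = (\<Sum>k<m. (indicator {\<omega>. \<forall>i\<le>k. \<omega> i \<notin> A} \<omega> :: ennreal))"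
      using m(1) by (intro suminf_finite) (auto simp: not_less indicator_def)
    also have "\<dots> = (\<Sum>k<m. 1)"
      using m(2) by (intro sum.cong) (force simp: indicator_def)+
    finally show ?thesis .
  qed
  ultimately show ?thesis by simp
next
  case False
  then have "hitting_time A \<omega> = \<infinity>"
    by (simp add: hitting_time_def top_enat_def)
  moreover have "(\<Sum>k. indicator {\<omega>. \<forall>i\<le>k. \<omega> i \<notin> A} \<omega>) = (\<Sum>k. (1::ennreal))"
    using False by (intro suminf_cong) auto
  moreover have "(\<Sum>k. (1::ennreal)) = top"
  proof -
    have "of_nat N \<le> (\<Sum>k. (1::ennreal))" for N
      using sum_le_suminf[of "\<lambda>_. 1::ennreal" "{..<N}"] by simp
    then show ?thesis
      by (metis ennreal_Ex_less_of_nat not_less top.not_eq_extremum)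
  qed
  ultimately show ?thesis by simp
qed

text \<open>The Foster-Lyapunov criterion. Let \<open>a k\<close> be the integral of \<open>\<Phi>\<close> of the state at time \<open>k\<close> over the
  trajectories that avoid \<open>A\<close> before time \<open>k\<close>. One step of the chain lowers \<open>a\<close> by at least the
  probability \<open>P k\<close> of avoiding \<open>A\<close> up to time \<open>k\<close>, so that these probabilities sum to at most
  \<open>a 0 = \<Phi> s\<close>. The potential takes values in \<^typ>\<open>ennreal\<close>: giving it the value \<open>\<infinity>\<close> off an invariant
  set of states restricts the drift condition to that set.\<close>

theorem expected_hitting_time_le_Lyapunov:
  fixes \<Phi> :: "'s \<Rightarrow> ennreal"
  assumes drift: "\<And>\<eta>. \<eta> \<notin> A \<Longrightarrow> (\<integral>\<^sup>+\<zeta>. \<Phi> \<zeta> \<partial>measure_pmf (K \<eta>)) + 1 \<le> \<Phi> \<eta>"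
  shows "(\<integral>\<^sup>+\<omega>. ennreal_of_enat (hitting_time A \<omega>) \<partial>chain_measure K s) \<le> \<Phi> s"
proof -
  interpret Ionescu_Tulcea "chain_kernel K s" "\<lambda>_. count_space UNIV"
    by (rule Ionescu_Tulcea_chain)
  \<comment> \<open>The joint law of the states at the times \<open>0, \<dots>, k\<close>.\<close>
  define M where "M k = C 0 (Suc k) (\<lambda>_. undefined)" for k
  let ?\<Pi> = "\<lambda>k. PiM {0..<Suc k} (\<lambda>_. count_space (UNIV::'s set))"
  have sM[measurable_cong]: "sets (M k) = sets (?\<Pi> k)" for k
    unfolding M_def using sets_C[of "\<lambda>_. undefined" 0 "Suc k"] by simp
  have spM: "space (M k) = space (?\<Pi> k)" for k
    by (rule sets_eq_imp_space_eq[OF sM])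
  have comp: "(\<lambda>\<omega>. \<omega> i) \<in> measurable (?\<Pi> k) (count_space UNIV)" if "i \<le> k" for i k
    using that by (intro measurable_component_singleton) auto
  have mcomp: "(\<lambda>\<omega>. f (\<omega> i)) \<in> borel_measurable (?\<Pi> k)" if "i \<le> k" for i k and f :: "'s \<Rightarrow> ennreal"
    by (rule measurable_compose[OF comp[OF that]]) simp
  have alive: "{\<omega>\<in>space (?\<Pi> k). \<forall>i\<le>j. \<omega> i \<notin> A} \<in> sets (?\<Pi> k)" if "j \<le> k" for j k
  proof -
    have "{\<omega>\<in>space (?\<Pi> k). \<omega> i \<notin> A} \<in> sets (?\<Pi> k)" if "i \<le> j" for i
      using measurable_sets[OF comp[of i k], of "- A"] that \<open>j \<le> k\<close>
      by (simp add: vimage_def Int_def conj_commute)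
    then have "space (?\<Pi> k) \<inter> (\<Inter>i\<in>{..j}. {\<omega>\<in>space (?\<Pi> k). \<omega> i \<notin> A}) \<in> sets (?\<Pi> k)"
      by (intro sets.Int sets.top sets.finite_INT) auto
    moreover have "space (?\<Pi> k) \<inter> (\<Inter>i\<in>{..j}. {\<omega>\<in>space (?\<Pi> k). \<omega> i \<notin> A})
        = {\<omega>\<in>space (?\<Pi> k). \<forall>i\<le>j. \<omega> i \<notin> A}" by auto
    ultimately show ?thesis by (simp only:)
  qed
  define I where "I j \<omega> = (indicator {\<omega>. \<forall>i\<le>j. \<omega> i \<notin> A} \<omega> :: ennreal)" for j :: nat and \<omega>
  have mI: "I j \<in> borel_measurable (?\<Pi> k)" if jk: "j \<le> k" for j k :: nat
  proof -
    let ?B = "{\<omega>\<in>space (?\<Pi> k). \<forall>i\<le>j. \<omega> i \<notin> A}"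
    have "indicator ?B \<in> borel_measurable (?\<Pi> k)"
      using alive[OF jk] by (rule borel_measurable_indicator)
    moreover have "I j \<omega> = indicator ?B \<omega>" if "\<omega> \<in> space (?\<Pi> k)" for \<omega>
      using that by (simp add: I_def indicator_def)
    ultimately show ?thesis
      by (subst measurable_cong)
  qed
  define a where "a k = (case k of 0 \<Rightarrow> \<Phi> s
     | Suc j \<Rightarrow> (\<integral>\<^sup>+\<omega>. I j \<omega> * \<Phi> (\<omega> (Suc j)) \<partial>M (Suc j)))" for k
  define P where "P k = (\<integral>\<^sup>+\<omega>. I k \<omega> \<partial>M k)" for k
  \<comment> \<open>The Markov property: the last coordinate is drawn from the kernel at the one before it.\<close>
  have step: "(\<integral>\<^sup>+\<omega>. f \<omega> \<partial>M (Suc k)) = (\<integral>\<^sup>+\<omega>. (\<integral>\<^sup>+y. f (fun_upd \<omega> (Suc k) y) \<partial>K (\<omega> k)) \<partial>M k)"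
    if f: "f \<in> borel_measurable (?\<Pi> (Suc k))" for f k
  proof -
    have "(\<integral>\<^sup>+\<omega>. f \<omega> \<partial>M (Suc k)) = (\<integral>\<^sup>+\<omega>. (\<integral>\<^sup>+x. f x \<partial>eP (Suc k) \<omega>) \<partial>M k)"
      unfolding M_def
      apply (subst C.simps(2))
      apply (subst nn_integral_bind[where B="?\<Pi> (Suc k)"])
      using f measurable_eP[of "Suc k"] sM[of k]
        apply (auto simp: M_def cong: measurable_cong_sets)
      done
    also have "\<dots> = (\<integral>\<^sup>+\<omega>. (\<integral>\<^sup>+y. f (fun_upd \<omega> (Suc k) y) \<partial>K (\<omega> k)) \<partial>M k)"
      by (intro nn_integral_cong, subst nn_integral_eP)
         (use f in \<open>auto simp: spM chain_kernel_def\<close>)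
    finally show ?thesis .
  qed
  have aS: "a (Suc k) = (\<integral>\<^sup>+\<omega>. I k \<omega> * (\<integral>\<^sup>+y. \<Phi> y \<partial>K (\<omega> k)) \<partial>M k)" for k
  proof -
    have "I k (fun_upd \<omega> (Suc k) y) = I k \<omega>" for \<omega> y
      by (auto simp: I_def split: split_indicator)
    then show ?thesis
      unfolding a_def nat.case
      by (subst step)
         (auto simp: nn_integral_cmult intro!: borel_measurable_times_ennreal mI mcomp)
  qed
  have dec: "a (Suc k) + P k \<le> a k" for k
  proof -
    have "a (Suc k) + P k = (\<integral>\<^sup>+\<omega>. I k \<omega> * (\<integral>\<^sup>+y. \<Phi> y \<partial>K (\<omega> k)) + I k \<omega> \<partial>M k)"
      unfolding aS P_def
      by (subst nn_integral_add)
         (auto simp: measurable_cong_sets[OF sM refl]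
           intro!: borel_measurable_times_ennreal mI mcomp[of k k "\<lambda>\<eta>. \<integral>\<^sup>+y. \<Phi> y \<partial>K \<eta>"])
    also have "\<dots> \<le> (\<integral>\<^sup>+\<omega>. I k \<omega> * \<Phi> (\<omega> k) \<partial>M k)"
    proof (rule nn_integral_mono)
      fix \<omega>
      show "I k \<omega> * (\<integral>\<^sup>+y. \<Phi> y \<partial>K (\<omega> k)) + I k \<omega> \<le> I k \<omega> * \<Phi> (\<omega> k)"
        using drift[of "\<omega> k"] by (auto simp: I_def split: split_indicator)
    qed
    also have "\<dots> \<le> a k"
    proof (cases k)
      case 0
      have "(\<integral>\<^sup>+\<omega>. I 0 \<omega> * \<Phi> (\<omega> 0) \<partial>M 0) \<le> (\<integral>\<^sup>+\<omega>. \<Phi> (\<omega> 0) \<partial>M 0)"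
        by (intro nn_integral_mono) (auto simp: I_def split: split_indicator)
      also have "(\<integral>\<^sup>+\<omega>. \<Phi> (\<omega> 0) \<partial>M 0) = (\<integral>\<^sup>+\<omega>. \<Phi> (\<omega> 0) \<partial>eP 0 (\<lambda>_. undefined))"
      proof -
        have "M 0 = return (PiM {0..<0} (\<lambda>_. count_space UNIV)) (\<lambda>_. undefined) \<bind> eP 0"
          by (simp add: M_def)
        also have "\<dots> = eP 0 (\<lambda>_. undefined)"
          by (rule bind_return[OF measurable_eP]) auto
        finally show ?thesis by simp
      qed
      also have "\<dots> = \<Phi> s"
        using mcomp[of 0 0 \<Phi>] by (subst nn_integral_eP) (auto simp: chain_kernel_def)
      finally show ?thesis by (simp add: a_def 0)
    next
      case (Suc j)
      show ?thesis unfolding a_def Suc nat.case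
        by (intro nn_integral_mono mult_right_mono) (auto simp: I_def split: split_indicator)
    qed
    finally show ?thesis .
  qed
  have part: "a N + (\<Sum>k<N. P k) \<le> \<Phi> s" for N
  proof (induction N)
    case 0 then show ?case by (simp add: a_def)
  next
    case (Suc N)
    have "a (Suc N) + (\<Sum>k<Suc N. P k) = a (Suc N) + P N + (\<Sum>k<N. P k)"
      by (simp add: add_ac)
    also have "\<dots> \<le> a N + (\<Sum>k<N. P k)"
      by (intro add_right_mono dec)
    finally show ?case using Suc by order
  qed
  have sets: "{\<omega>. \<forall>i\<le>k. \<omega> i \<notin> A} \<in> sets (chain_measure K s)"
    and P: "emeasure (chain_measure K s) {\<omega>. \<forall>i\<le>k. \<omega> i \<notin> A} = P k" for k
  proof -
    let ?X = "{\<omega>\<in>space (?\<Pi> k). \<forall>i\<le>k. \<omega> i \<notin> A}"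
    have e: "{\<omega>. \<forall>i\<le>k. \<omega> i \<notin> A} = PF.emb UNIV {0..<Suc k} ?X"
      by (auto simp: prod_emb_def space_PiM less_Suc_eq_le PiE_iff)
    show "{\<omega>. \<forall>i\<le>k. \<omega> i \<notin> A} \<in> sets (chain_measure K s)"
      unfolding e sets_chain_measure by (intro measurable_prod_emb alive) auto
    have "emeasure (chain_measure K s) {\<omega>. \<forall>i\<le>k. \<omega> i \<notin> A} = emeasure (CI {0..<Suc k}) ?X"
      unfolding e chain_measure_def by (intro lim alive) auto
    also have "\<dots> = emeasure (M k) (PF.emb {0..<Suc k} {0..<Suc k} ?X)"
      unfolding M_def by (intro emeasure_CI alive) auto
    also have "PF.emb {0..<Suc k} {0..<Suc k} ?X = ?X"
      by (intro prod_emb_id) (auto simp: space_PiM)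
    also have "emeasure (M k) ?X = (\<integral>\<^sup>+\<omega>. indicator ?X \<omega> \<partial>M k)"
      using alive[of k k] by (intro nn_integral_indicator[symmetric]) (simp only: sM order_refl)
    also have "\<dots> = P k"
      unfolding P_def by (intro nn_integral_cong) (simp add: spM I_def indicator_def)
    finally show "emeasure (chain_measure K s) {\<omega>. \<forall>i\<le>k. \<omega> i \<notin> A} = P k" .
  qed
  have "(\<integral>\<^sup>+\<omega>. ennreal_of_enat (hitting_time A \<omega>) \<partial>chain_measure K s) = (\<Sum>k. P k)"
    unfolding ennreal_of_enat_hitting_time using sets
    by (subst nn_integral_suminf) (auto simp: P)
  also have "\<dots> \<le> \<Phi> s"
  proof (rule suminf_le_const)
    show "(\<Sum>k<N. P k) \<le> \<Phi> s" for N
      using part[of N] by (rule order_trans[rotated]) simp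
  qed simp
  finally show ?thesis .
qed

section \<open>The pair gap of a height function\<close>

definition pair_gap :: "'v set \<Rightarrow> ('v \<Rightarrow> int) \<Rightarrow> real" where
  "pair_gap V W = (\<Sum>x\<in>V. \<Sum>y\<in>V. \<bar>real_of_int (W x - W y)\<bar>)"

text \<open>With \<open>m j\<close> vertices on or above level \<open>j\<close>, the pair gap is \<open>2 \<Sum>j. m j (n - m j)\<close>, where \<open>n\<close> is the
  number of vertices. Replacing \<open>m\<close> by \<open>m + 1\<close> changes \<open>m (n - m)\<close> by \<open>(n - 2 m) - 1\<close>, and replacing it by \<open>m - 1\<close>
  changes it by \<open>- (n - 2 m) - 1\<close>: the slope enters with opposite signs, and the \<open>- 1\<close> from the
  concavity enters both times. The latter is what makes the pair gap decrease on average.\<close>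

definition level_slope :: "'v set \<Rightarrow> ('v \<Rightarrow> int) \<Rightarrow> int \<Rightarrow> real" where
  "level_slope V W j = real (card V) - 2 * real (card {y\<in>V. j \<le> W y})"

lemma level_slope_mono:
  assumes "finite V" "i \<le> j"
  shows "level_slope V W i \<le> level_slope V W j"
proof -
  have "card {y\<in>V. j \<le> W y} \<le> card {y\<in>V. i \<le> W y}"
    using assms by (intro card_mono) auto
  then show ?thesis by (simp add: level_slope_def)
qed

lemma abs_level_slope_le:
  assumes "finite V"
  shows "\<bar>level_slope V W j\<bar> \<le> real (card V)"
proof -
  have "card {y\<in>V. j \<le> W y} \<le> card V"
    using assms by (intro card_mono) auto
  then show ?thesis by (simp add: level_slope_def)
qed

lemma pair_gap_upd:
  assumes "finite V" "z \<in> V"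
  shows "pair_gap V (W(z := k)) = pair_gap (V - {z}) W + 2 * (\<Sum>y\<in>V - {z}. \<bar>real_of_int (k - W y)\<bar>)"
proof -
  let ?W = "W(z := k)"
  have "pair_gap V ?W = (\<Sum>y\<in>V. \<bar>real_of_int (?W z - ?W y)\<bar>)
      + (\<Sum>x\<in>V - {z}. \<Sum>y\<in>V. \<bar>real_of_int (?W x - ?W y)\<bar>)"
    unfolding pair_gap_def using assms by (rule sum.remove)
  also have "(\<Sum>y\<in>V. \<bar>real_of_int (?W z - ?W y)\<bar>) = (\<Sum>y\<in>V - {z}. \<bar>real_of_int (k - W y)\<bar>)"
    using assms by (subst sum.remove[of V z]) (auto intro!: sum.cong)
  also have "(\<Sum>x\<in>V - {z}. \<Sum>y\<in>V. \<bar>real_of_int (?W x - ?W y)\<bar>)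
      = (\<Sum>x\<in>V - {z}. \<bar>real_of_int (k - W x)\<bar> + (\<Sum>y\<in>V - {z}. \<bar>real_of_int (W x - W y)\<bar>))"
  proof (rule sum.cong[OF refl])
    fix x assume "x \<in> V - {z}"
    then show "(\<Sum>y\<in>V. \<bar>real_of_int (?W x - ?W y)\<bar>)
        = \<bar>real_of_int (k - W x)\<bar> + (\<Sum>y\<in>V - {z}. \<bar>real_of_int (W x - W y)\<bar>)"
      using assms by (subst sum.remove[of V z]) (auto simp: abs_minus_commute)
  qed
  finally show ?thesis
    by (simp add: sum.distrib pair_gap_def)
qed

lemma sum_level_indicator:
  assumes "finite U"
  shows "(\<Sum>y\<in>U. 1 - 2 * of_bool (j \<le> W y)) = real (card U) - 2 * real (card {y\<in>U. j \<le> W y})"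
  using assms by (simp add: sum_subtractf Int_def flip: sum_distrib_left)

text \<open>Lowering \<open>z\<close> by one removes it from a single level set, and raising it adds it to a single one.
  Both changes contain the term \<open>- 2\<close>, the effect of concavity; the terms with the slope are
  first order and have opposite signs for the two directions.\<close>

lemma pair_gap_lower:
  assumes "finite V" "z \<in> V"
  shows "pair_gap V (W(z := W z - 1)) = pair_gap V W - 2 * level_slope V W (W z) - 2"
proof -
  have "pair_gap V (W(z := W z - 1)) - pair_gap V (W(z := W z))
      = 2 * (\<Sum>y\<in>V - {z}. \<bar>real_of_int (W z - 1 - W y)\<bar> - \<bar>real_of_int (W z - W y)\<bar>)"
    unfolding pair_gap_upd[OF assms] by (simp add: sum_subtractf)
  also have "(\<Sum>y\<in>V - {z}. \<bar>real_of_int (W z - 1 - W y)\<bar> - \<bar>real_of_int (W z - W y)\<bar>)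
      = - (\<Sum>y\<in>V - {z}. 1 - 2 * of_bool (W z \<le> W y))"
    unfolding sum_negf[symmetric] by (intro sum.cong) auto
  also have "\<dots> = - (real (card (V - {z})) - 2 * real (card ({y\<in>V. W z \<le> W y} - {z})))"
  proof -
    have "{y\<in>V - {z}. W z \<le> W y} = {y\<in>V. W z \<le> W y} - {z}" by auto
    then show ?thesis using assms by (subst sum_level_indicator) simp_all
  qed
  also have "\<dots> = - level_slope V W (W z) - 1"
  proof -
    have "card V \<ge> 1" "card {y\<in>V. W z \<le> W y} \<ge> 1"
      using assms by (auto simp: Suc_le_eq card_gt_0_iff)
    then show ?thesis using assms by (simp add: level_slope_def card_Diff_singleton of_nat_diff)
  qed
  finally show ?thesis by (simp add: algebra_simps del: fun_upd_apply)
qed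

lemma pair_gap_raise:
  assumes "finite V" "z \<in> V"
  shows "pair_gap V (W(z := W z + 1)) = pair_gap V W + 2 * level_slope V W (W z + 1) - 2"
proof -
  have "pair_gap V (W(z := W z + 1)) - pair_gap V (W(z := W z))
      = 2 * (\<Sum>y\<in>V - {z}. \<bar>real_of_int (W z + 1 - W y)\<bar> - \<bar>real_of_int (W z - W y)\<bar>)"
    unfolding pair_gap_upd[OF assms] by (simp add: sum_subtractf)
  also have "(\<Sum>y\<in>V - {z}. \<bar>real_of_int (W z + 1 - W y)\<bar> - \<bar>real_of_int (W z - W y)\<bar>)
      = (\<Sum>y\<in>V - {z}. 1 - 2 * of_bool (W z + 1 \<le> W y))"
    by (intro sum.cong) auto
  also have "\<dots> = real (card (V - {z})) - 2 * real (card {y\<in>V. W z + 1 \<le> W y})"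
    using assms by (subst sum_level_indicator) (auto intro!: arg_cong[where f=card])
  also have "\<dots> = level_slope V W (W z + 1) - 1"
  proof -
    have "card V \<ge> 1"
      using assms by (auto simp: Suc_le_eq card_gt_0_iff)
    then show ?thesis using assms by (simp add: level_slope_def card_Diff_singleton of_nat_diff)
  qed
  finally show ?thesis by (simp add: algebra_simps del: fun_upd_apply)
qed

section \<open>Currents on a ring\<close>

text \<open>An edge with heights \<open>a < b\<close> at its ends crosses the levels \<open>a + 1, \<dots>, b\<close>, and \<open>level_sum b - level_sum a\<close>
  weights every level by its index, which is the rate at which a particle falls from a vertex of that
  height. Level 1 is left out: falls from height 1 into a hole are compared with a different current.\<close>

definition level_sum :: "nat \<Rightarrow> real" where
  "level_sum k = (\<Sum>b=2..k. real b)"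

lemma level_sum_0 [simp]: "level_sum 0 = 0" and level_sum_1 [simp]: "level_sum (Suc 0) = 0"
  by (simp_all add: level_sum_def)

lemma level_sum_nonneg: "level_sum k \<ge> 0"
  by (auto simp: level_sum_def intro: sum_nonneg)

lemma level_sum_Suc: "k \<ge> 1 \<Longrightarrow> level_sum (Suc k) = level_sum k + real (Suc k)"
  by (simp add: level_sum_def)

lemma level_sum_mono: "a \<le> b \<Longrightarrow> level_sum a \<le> level_sum b"
  unfolding level_sum_def by (intro sum_mono2) auto

lemma level_sum_ge: "k \<ge> 2 \<Longrightarrow> level_sum k \<ge> real k"
  unfolding level_sum_def by (rule member_le_sum) auto

lemma level_sum_diff_le: "a \<le> b \<Longrightarrow> level_sum b - level_sum a \<le> real b * real (b - a)"
proof -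
  assume "a \<le> b"
  then have "{2..b} = {2..a} \<union> {max 2 (Suc a)..b}" "{2..a} \<inter> {max 2 (Suc a)..b} = {}"
    by auto
  then have "level_sum b - level_sum a = (\<Sum>k=max 2 (Suc a)..b. real k)"
    unfolding level_sum_def by (subst (1) \<open>{2..b} = _\<close>, subst sum.union_disjoint) auto
  also have "\<dots> \<le> (\<Sum>k=max 2 (Suc a)..b. real b)"
    by (intro sum_mono) auto
  also have "\<dots> = real b * real (card {max 2 (Suc a)..b})" by simp
  also have "\<dots> \<le> real b * real (b - a)"
    by (intro mult_left_mono) auto
  finally show ?thesis .
qed

text \<open>The vertices form a disjoint union of cycles with successor \<open>s\<close> and predecessor \<open>p\<close>. The function \<open>W\<close> integrates the
  surplus \<open>h - 1\<close>; it exists only if there are as many particles as vertices, and it is then unique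
  up to an additive constant on each cycle. A jump from \<open>x\<close> to \<open>s x\<close> lowers \<open>W\<close> at \<open>x\<close> by one, a
  jump from \<open>x\<close> to \<open>p x\<close> raises \<open>W\<close> at \<open>p x\<close> by one, and the flat state corresponds to constant \<open>W\<close>.\<close>

locale height_profile =
  fixes V :: "'v set" and s p :: "'v \<Rightarrow> 'v" and h :: "'v \<Rightarrow> nat" and W :: "'v \<Rightarrow> int"
  assumes finite_V: "finite V"
    and s_in: "x \<in> V \<Longrightarrow> s x \<in> V" and p_in: "x \<in> V \<Longrightarrow> p x \<in> V"
    and p_s [simp]: "x \<in> V \<Longrightarrow> p (s x) = x" and s_p [simp]: "x \<in> V \<Longrightarrow> s (p x) = x"
    and s_neq: "x \<in> V \<Longrightarrow> s x \<noteq> x"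
    and W_step: "x \<in> V \<Longrightarrow> W x = W (p x) + int (h x) - 1"
begin

text \<open>The probabilities that a particle chosen at \<open>x\<close> jumps to \<open>s x\<close> and to \<open>p x\<close>; both are 0 at a
  vertex that is not free.\<close>

definition right_prob :: "'v \<Rightarrow> real" where
  "right_prob x = (if h (s x) < h x then
     (if h (s x) < h (p x) then 1 else if h (s x) = h (p x) then 1/2 else 0) else 0)"

definition left_prob :: "'v \<Rightarrow> real" where
  "left_prob x = (if h (p x) < h x then
     (if h (p x) < h (s x) then 1 else if h (p x) = h (s x) then 1/2 else 0) else 0)"

text \<open>A fall by one level exchanges two neighboring heights and leaves the sum of squares unchanged, so
  only the depth of a fall beyond one lowers it. Truncated subtraction makes the excess 0 at a vertex
  that is not free.\<close>

definition excess_drop :: "'v \<Rightarrow> real" where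
  "excess_drop x = real (h x - min (h (p x)) (h (s x)) - 1)"

abbreviation c :: "int \<Rightarrow> real" where
  "c \<equiv> level_slope V W"

lemma c_mono: "i \<le> j \<Longrightarrow> c i \<le> c j"
  using finite_V by (rule level_slope_mono)

lemma sum_shift: "(\<Sum>x\<in>V. f (s x)) = (\<Sum>x\<in>V. f x)"
  by (rule sum.reindex_bij_witness[of _ p s]) (auto simp: s_in p_in)

text \<open>Let every edge carry, at each level \<open>b \<ge> 2\<close> that it crosses, a current of strength \<open>b\<close> downhill. For
  a fixed level, the vertices of height at least \<open>b\<close> form arcs, along which \<open>W\<close> increases, and each arc
  has one outflow to the left at a low slope and one outflow to the right at a high slope. Hence the
  balance is not positive. Summation by parts turns this into one term per vertex, and the right-hand
  side keeps what is left over, because the actual current at local maxima is only half as large.\<close>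

lemma sum_level_current_le:
  "(\<Sum>x\<in>V. max 0 (level_sum (h x) - level_sum (h (p x))) * c (W (p x) + 1)
        - max 0 (level_sum (h x) - level_sum (h (s x))) * c (W x))
    \<le> - (\<Sum>x\<in>V. level_sum (h x) * (c (W x) - c (W (p x) + 1)))" (is "?L \<le> ?R")
proof -
  let ?t = "\<lambda>x. level_sum (h x)"
  have 1: "(\<Sum>x\<in>V. max 0 (?t x - ?t (s x)) * c (W x)) = (\<Sum>x\<in>V. max 0 (?t (p x) - ?t x) * c (W (p x)))"
    using sum_shift[of "\<lambda>x. max 0 (?t (p x) - ?t x) * c (W (p x))"] by simp
  have 2: "(\<Sum>x\<in>V. ?t x * c (W x)) = (\<Sum>x\<in>V. ?t (p x) * c (W (p x)))"
    using sum_shift[of "\<lambda>x. ?t (p x) * c (W (p x))"] by simp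
  have "?L = (\<Sum>x\<in>V. max 0 (?t x - ?t (p x)) * c (W (p x) + 1) - max 0 (?t (p x) - ?t x) * c (W (p x)))
      + (\<Sum>x\<in>V. ?t (p x) * c (W (p x))) - (\<Sum>x\<in>V. ?t x * c (W x))"
    unfolding sum_subtractf 1 2 by simp
  also have "\<dots> = (\<Sum>x\<in>V. max 0 (?t x - ?t (p x)) * (c (W (p x) + 1) - c (W (p x)))
      + ?t x * (c (W (p x)) - c (W x)))"
    unfolding sum_subtractf[symmetric] sum.distrib[symmetric]
    by (intro sum.cong) (auto simp: max_def algebra_simps)
  also have "\<dots> \<le> (\<Sum>x\<in>V. ?t x * (c (W (p x) + 1) - c (W (p x))) + ?t x * (c (W (p x)) - c (W x)))"
    using c_mono by (intro sum_mono add_right_mono mult_right_mono)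
      (auto simp: level_sum_nonneg max_def add_increasing)
  also have "\<dots> = ?R"
    unfolding sum_negf[symmetric] by (intro sum.cong) (auto simp: algebra_simps)
  finally show ?thesis .
qed

text \<open>The rate at which a jump to the right from \<open>x\<close> fills a hole, except that the rate is set to 1 at vertices of
  height at least 2. There a fall into a hole is deep, and the error is paid for by the sum of squares.\<close>

definition hole_right :: "'v \<Rightarrow> real" where
  "hole_right x = (if h (s x) \<noteq> 0 \<or> h x = 0 then 0 else if h x = 1 \<and> h (p x) = 0 then 1/2 else 1)"

definition hole_left :: "'v \<Rightarrow> real" where
  "hole_left x = (if h (p x) \<noteq> 0 \<or> h x = 0 then 0 else if h x = 1 \<and> h (s x) = 0 then 1/2 else 1)"

text \<open>A hole \<open>q\<close> is a step of \<open>W\<close> from level \<open>W (p q)\<close> down by one, which particles from either side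
  push with the same slope \<open>c (W (p q))\<close>. An isolated hole is pushed equally from both sides. The two
  rates differ only if another hole is at distance one or two, and then the deficit on the
  right side of a hole matches that on the left side of the next one, where the slope is at most as large.\<close>

lemma sum_hole_current_nonpos:
  "(\<Sum>x\<in>V. hole_left x * c (W (p x) + 1) - hole_right x * c (W x)) \<le> 0"
proof -
  \<comment> \<open>The deficits of the rates at a hole \<open>q\<close>, for a next hole at distance one (\<open>1\<close>) or two (\<open>2\<close>),
    to its right (\<open>u\<close>) or to its left (\<open>v\<close>).\<close>
  define u1 where "u1 q = (of_bool (h q = 0 \<and> h (s q) = 0) :: real)" for q
  define u2 where "u2 q = (of_bool (h q = 0 \<and> h (s q) = 1 \<and> h (s (s q)) = 0) / 2 :: real)" for q
  define v1 where "v1 q = (of_bool (h q = 0 \<and> h (p q) = 0) :: real)" for q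
  define v2 where "v2 q = (of_bool (h q = 0 \<and> h (p q) = 1 \<and> h (p (p q)) = 0) / 2 :: real)" for q
  have L: "(\<Sum>x\<in>V. hole_left x * c (W (p x) + 1)) = (\<Sum>q\<in>V. hole_left (s q) * c (W q + 1))"
    using sum_shift[of "\<lambda>x. hole_left x * c (W (p x) + 1)"] by simp
  have R: "(\<Sum>x\<in>V. hole_right x * c (W x)) = (\<Sum>q\<in>V. hole_right (p q) * c (W (p q)))"
    using sum_shift[of "\<lambda>q. hole_right (p q) * c (W (p q))"] by simp
  have v1: "(\<Sum>q\<in>V. v1 q * c (W (p q))) = (\<Sum>q\<in>V. u1 q * c (W q))"
  proof -
    have "(\<Sum>q\<in>V. u1 q * c (W q)) = (\<Sum>q\<in>V. v1 (s q) * c (W (p (s q))))"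
      by (intro sum.cong) (auto simp: u1_def v1_def)
    then show ?thesis using sum_shift[of "\<lambda>q. v1 q * c (W (p q))"] by simp
  qed
  have v2: "(\<Sum>q\<in>V. v2 q * c (W (p q))) = (\<Sum>q\<in>V. u2 q * c (W (s q)))"
  proof -
    have "(\<Sum>q\<in>V. u2 q * c (W (s q))) = (\<Sum>q\<in>V. v2 (s (s q)) * c (W (p (s (s q)))))"
      by (intro sum.cong) (auto simp: u2_def v2_def s_in)
    also have "\<dots> = (\<Sum>q\<in>V. v2 (s q) * c (W (p (s q))))"
      by (rule sum_shift)
    also have "\<dots> = (\<Sum>q\<in>V. v2 q * c (W (p q)))"
      by (rule sum_shift)
    finally show ?thesis by simp
  qed
  have "(\<Sum>x\<in>V. hole_left x * c (W (p x) + 1) - hole_right x * c (W x))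
      = (\<Sum>q\<in>V. hole_left (s q) * c (W q + 1) - hole_right (p q) * c (W (p q)))"
    by (simp add: sum_subtractf L R)
  also have "\<dots> = (\<Sum>q\<in>V. v1 q * c (W (p q)) + v2 q * c (W (p q)) - u1 q * c (W (p q)) - u2 q * c (W (p q)))"
  proof (rule sum.cong[OF refl])
    fix q assume q: "q \<in> V"
    show "hole_left (s q) * c (W q + 1) - hole_right (p q) * c (W (p q))
      = v1 q * c (W (p q)) + v2 q * c (W (p q)) - u1 q * c (W (p q)) - u2 q * c (W (p q))"
    proof (cases "h q = 0")
      case True
      then have "W q + 1 = W (p q)" using W_step[OF q] by simp
      then have "c (W q + 1) = c (W (p q))" by simp
      then show ?thesis using q True
        by (simp add: hole_left_def hole_right_def u1_def u2_def v1_def v2_def)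
    next
      case False
      then show ?thesis using q
        by (simp add: hole_left_def hole_right_def u1_def u2_def v1_def v2_def)
    qed
  qed
  also have "\<dots> = (\<Sum>q\<in>V. u1 q * (c (W q) - c (W (p q))) + u2 q * (c (W (s q)) - c (W (p q))))"
    by (simp add: sum_subtractf sum.distrib v1 v2 right_diff_distrib)
  also have "\<dots> \<le> 0"
  proof (rule sum_nonpos)
    fix q assume q: "q \<in> V"
    have "u1 q * (c (W q) - c (W (p q))) \<le> 0"
      using W_step[OF q] c_mono[of "W q" "W (p q)"] by (auto simp: u1_def)
    moreover have "u2 q * (c (W (s q)) - c (W (p q))) \<le> 0"
      using W_step[OF q] W_step[OF s_in[OF q]] c_mono[of "W (s q)" "W (p q)"] q
      by (auto simp: u2_def)
    ultimately show "u1 q * (c (W q) - c (W (p q))) + u2 q * (c (W (s q)) - c (W (p q))) \<le> 0"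
      by simp
  qed
  finally show ?thesis .
qed

text \<open>The actual current at a vertex compared with the two reference currents. For height at most 1 it is the
  hole current. For height at least 2 and a fall by one level it is the level current, or half
  of it at a strict local maximum, and then the leftover of the level current covers the other half. For a fall
  of depth \<open>d \<ge> 2\<close>, all currents are bounded by their absolute values.\<close>

lemma vertex_current_le:
  assumes x: "x \<in> V"
  shows "real (h x) * (left_prob x * c (W (p x) + 1) - right_prob x * c (W x))
    \<le> (max 0 (level_sum (h x) - level_sum (h (p x))) * c (W (p x) + 1)
        - max 0 (level_sum (h x) - level_sum (h (s x))) * c (W x))
      + (hole_left x * c (W (p x) + 1) - hole_right x * c (W x))
      + level_sum (h x) * (c (W x) - c (W (p x) + 1))
      + 6 * real (card V) * (real (h x) * excess_drop x)"
proof -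
  define X where "X = c (W x)"
  define Y where "Y = c (W (p x) + 1)"
  define n where "n = real (card V)"
  define R where "R = max 0 (level_sum (h x) - level_sum (h (s x)))"
  define L where "L = max 0 (level_sum (h x) - level_sum (h (p x)))"
  let ?b = "h x" and ?a = "h (p x)" and ?c = "h (s x)"
  have X: "\<bar>X\<bar> \<le> n" and Y: "\<bar>Y\<bar> \<le> n"
    unfolding X_def Y_def n_def using finite_V by (rule abs_level_slope_le)+
  have n: "n \<ge> 0" by (simp add: n_def)
  have "real ?b * (left_prob x * Y - right_prob x * X) \<le> (L * Y - R * X)
      + (hole_left x * Y - hole_right x * X) + level_sum ?b * (X - Y) + 6 * n * (real ?b * excess_drop x)"
  proof (cases "?b \<le> 1")
    case True
    then consider "?b = 0" | "?b = 1" by linarith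
    then show ?thesis
    proof cases
      case 1
      then have "L = 0" "R = 0"
        using level_sum_nonneg[of ?a] level_sum_nonneg[of ?c] by (simp_all add: L_def R_def)
      with 1 show ?thesis
        by (simp add: hole_left_def hole_right_def)
    next
      case 2
      then have "left_prob x = hole_left x" "right_prob x = hole_right x"
        by (auto simp: left_prob_def right_prob_def hole_left_def hole_right_def)
      moreover have "L = 0" "R = 0"
        using 2 level_sum_nonneg[of ?a] level_sum_nonneg[of ?c] by (simp_all add: L_def R_def)
      moreover have "excess_drop x \<ge> 0" by (simp add: excess_drop_def)
      ultimately show ?thesis using 2 n by simp
    qed
  next
    case False
    then have b: "?b \<ge> 2" by simp
    have YX: "Y \<le> X"
      unfolding X_def Y_def using W_step[OF x] b by (intro c_mono) simp
    have slack: "level_sum ?b * (X - Y) \<ge> real ?b * (X - Y)"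
      using level_sum_ge[OF b] YX by (intro mult_right_mono) auto
    have slack0: "real ?b * (X - Y) \<ge> 0"
      using YX by simp
    \<comment> \<open>A downhill edge with a drop by one crosses only the top level.\<close>
    have drop1: "max 0 (level_sum ?b - level_sum k) = (if k < ?b then real ?b else 0)" if "k \<ge> ?b - 1" for k
    proof (cases "k < ?b")
      case True
      then have "?b = Suc k" using that by simp
      then show ?thesis using level_sum_Suc[of k] b by simp
    qed (use level_sum_mono[of ?b k] in auto)
    consider "min ?a ?c \<ge> ?b" | "min ?a ?c = ?b - 1" | "min ?a ?c + 2 \<le> ?b" by linarith
    then show ?thesis
    proof cases
      case 1
      then have "L = 0" "R = 0" "left_prob x = 0" "right_prob x = 0" "hole_left x = 0" "hole_right x = 0"
        using b drop1[of ?a] drop1[of ?c]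
        by (auto simp: L_def R_def left_prob_def right_prob_def hole_left_def hole_right_def)
      then show ?thesis using slack slack0 n by (simp add: excess_drop_def)
    next
      case 2
      have h0: "hole_left x = 0" "hole_right x = 0" "excess_drop x = 0"
        using 2 b by (auto simp: hole_left_def hole_right_def excess_drop_def)
      have LR: "L = (if ?a < ?b then real ?b else 0)" "R = (if ?c < ?b then real ?b else 0)"
      proof -
        have "?a \<ge> ?b - 1" "?c \<ge> ?b - 1" using 2 by linarith+
        then show "L = (if ?a < ?b then real ?b else 0)" "R = (if ?c < ?b then real ?b else 0)"
          unfolding L_def R_def by (simp_all only: drop1)
      qed
      consider "?a = ?b - 1" "?c \<ge> ?b" | "?a \<ge> ?b" "?c = ?b - 1" | "?a = ?b - 1" "?c = ?b - 1"
        using 2 b by linarith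
      then show ?thesis
      proof cases
        case 1
        then have "left_prob x = 1" "right_prob x = 0" "L = real ?b" "R = 0"
          using b LR by (auto simp: left_prob_def right_prob_def)
        then show ?thesis using h0 slack slack0 by simp
      next
        case 2
        then have "left_prob x = 0" "right_prob x = 1" "L = 0" "R = real ?b"
          using b LR by (auto simp: left_prob_def right_prob_def)
        then show ?thesis using h0 slack slack0 by simp
      next
        case 3
        then have e: "left_prob x = 1/2" "right_prob x = 1/2" "L = real ?b" "R = real ?b"
          using b LR by (auto simp: left_prob_def right_prob_def)
        show ?thesis unfolding e h0 using slack slack0 by (simp add: field_simps)
      qed
    next
      case 3
      define d where "d = real (?b - min ?a ?c)"
      have ed: "excess_drop x = d - 1" and d: "d \<ge> 2"
        using 3 by (auto simp: excess_drop_def d_def)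
      have jump: "left_prob x * Y - right_prob x * X \<le> n"
        using 3 X Y by (auto simp: left_prob_def right_prob_def min_def abs_le_iff split: if_splits)
      have bound: "max 0 (level_sum ?b - level_sum k) \<le> real ?b * d" if "k \<ge> min ?a ?c" for k
      proof (cases "k \<le> ?b")
        case True
        have "level_sum ?b - level_sum k \<le> real ?b * real (?b - k)"
          using True by (rule level_sum_diff_le)
        also have "\<dots> \<le> real ?b * d"
          unfolding d_def using that by (intro mult_left_mono) auto
        finally show ?thesis using d by simp
      next
        case False
        then show ?thesis using level_sum_mono[of ?b k] d by simp
      qed
      have L: "0 \<le> L" "L \<le> real ?b * d" and R: "0 \<le> R" "R \<le> real ?b * d"
        unfolding L_def R_def by (rule max.cobounded1 bound min.cobounded1 min.cobounded2)+
      have hl: "0 \<le> hole_left x" "hole_left x \<le> 1" and hr: "0 \<le> hole_right x" "hole_right x \<le> 1"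
        by (auto simp: hole_left_def hole_right_def)
      have prod: "- (K * n) \<le> k * Z" "- (K * n) \<le> - (k * Z)"
        if "0 \<le> k" "k \<le> K" "\<bar>Z\<bar> \<le> n" for k K Z
      proof -
        have "\<bar>k * Z\<bar> \<le> K * n"
          unfolding abs_mult using that by (intro mult_mono) auto
        then show "- (K * n) \<le> k * Z" "- (K * n) \<le> - (k * Z)" by auto
      qed
      \<comment> \<open>The factor 6 is what the sum of all bounds needs: \<open>b + 2 b d + 2 \<le> 6 b (d - 1)\<close> for \<open>b, d \<ge> 2\<close>.\<close>
      have "real ?b * (left_prob x * Y - right_prob x * X) \<le> real ?b * n"
        using jump by (intro mult_left_mono) auto
      also have "\<dots> \<le> (6 * (real ?b * (d - 1)) - 2 * (real ?b * d) - 2) * n"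
      proof (rule mult_right_mono[OF _ n])
        have "real ?b * 2 \<le> real ?b * d" using d by (intro mult_left_mono) auto
        then show "real ?b \<le> 6 * (real ?b * (d - 1)) - 2 * (real ?b * d) - 2"
          unfolding right_diff_distrib using b by linarith
      qed
      also have "\<dots> = - (real ?b * d * n) - (real ?b * d * n) - 1 * n - 1 * n + 6 * n * (real ?b * excess_drop x)"
        unfolding ed by (simp add: algebra_simps)
      also have "\<dots> \<le> L * Y - R * X + (hole_left x * Y - hole_right x * X) + 6 * n * (real ?b * excess_drop x)"
        using prod(1)[OF L Y] prod(2)[OF R X] prod(1)[OF hl Y] prod(2)[OF hr X] by linarith
      finally show ?thesis using slack slack0 by linarith
    qed
  qed
  then show ?thesis by (simp only: X_def Y_def L_def R_def n_def)
qed

text \<open>The first-order part of the drift of the pair gap is bounded by the drift of the sum of squares. Together with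
  the second-order part, which is negative at every jump, this is the key estimate.\<close>

theorem sum_current_le:
  "(\<Sum>x\<in>V. real (h x) * (left_prob x * c (W (p x) + 1) - right_prob x * c (W x)))
    \<le> 6 * real (card V) * (\<Sum>x\<in>V. real (h x) * excess_drop x)"
proof -
  have "(\<Sum>x\<in>V. real (h x) * (left_prob x * c (W (p x) + 1) - right_prob x * c (W x)))
      \<le> (\<Sum>x\<in>V. (max 0 (level_sum (h x) - level_sum (h (p x))) * c (W (p x) + 1)
        - max 0 (level_sum (h x) - level_sum (h (s x))) * c (W x))
      + (hole_left x * c (W (p x) + 1) - hole_right x * c (W x))
      + level_sum (h x) * (c (W x) - c (W (p x) + 1))
      + 6 * real (card V) * (real (h x) * excess_drop x))"
    by (intro sum_mono vertex_current_le)
  also have "\<dots> \<le> 6 * real (card V) * (\<Sum>x\<in>V. real (h x) * excess_drop x)"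
    using sum_level_current_le sum_hole_current_nonpos
    unfolding sum.distrib sum_distrib_left[symmetric] by linarith
  finally show ?thesis .
qed

end

section \<open>Energy of a pile on a ring and its drift\<close>

text \<open>The factor is the constant of the current estimate, so that the decrease of the sum of squares, twice the
  excess drop at every jump, absorbs the first-order change of the pair gap.\<close>

definition pile_energy :: "'v set \<Rightarrow> ('v \<Rightarrow> nat) \<Rightarrow> ('v \<Rightarrow> int) \<Rightarrow> real" where
  "pile_energy V h W = pair_gap V W + 6 * real (card V) * (\<Sum>v\<in>V. (real (h v))\<^sup>2)"

lemma sum_move:
  assumes "finite V" "x \<in> V" "y \<in> V" "h y < h x"
  shows "(\<Sum>v\<in>V. move h x y v) = (\<Sum>v\<in>V. h v)"
proof -
  have xy: "x \<noteq> y" using assms by auto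
  have split: "(\<Sum>v\<in>V. f v) = f x + (f y + (\<Sum>v\<in>V - {x} - {y}. f v))" for f :: "'a \<Rightarrow> nat"
    using assms xy by (simp add: sum.remove[of V x] sum.remove[of "V - {x}" y])
  have rest: "(\<Sum>v\<in>V - {x} - {y}. move h x y v) = (\<Sum>v\<in>V - {x} - {y}. h v)"
    by (intro sum.cong) (auto simp: move_def)
  show ?thesis
    unfolding split[of "move h x y"] split[of h] rest using assms xy by (simp add: move_def)
qed

lemma sum_squares_move:
  assumes "finite V" "x \<in> V" "y \<in> V" "h y < h x"
  shows "(\<Sum>v\<in>V. (real (move h x y v))\<^sup>2) = (\<Sum>v\<in>V. (real (h v))\<^sup>2) - 2 * real (h x - h y - 1)"
proof -
  have xy: "x \<noteq> y" using assms by auto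
  have split: "(\<Sum>v\<in>V. f v) = f x + (f y + (\<Sum>v\<in>V - {x} - {y}. f v))" for f :: "'a \<Rightarrow> real"
    using assms xy by (simp add: sum.remove[of V x] sum.remove[of "V - {x}" y])
  have rest: "(\<Sum>v\<in>V - {x} - {y}. (real (move h x y v))\<^sup>2) = (\<Sum>v\<in>V - {x} - {y}. (real (h v))\<^sup>2)"
    by (intro sum.cong) (auto simp: move_def)
  have ends: "real (move h x y x) = real (h x) - 1" "real (move h x y y) = real (h y) + 1"
    using assms xy by (auto simp: move_def of_nat_diff)
  have drop: "real (h x - h y - 1) = real (h x) - real (h y) - 1"
    using assms by (simp add: of_nat_diff)
  show ?thesis
    unfolding split[of "\<lambda>v. (real (move h x y v))\<^sup>2"] split[of "\<lambda>v. (real (h v))\<^sup>2"] rest ends drop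
    by (simp add: power2_eq_square algebra_simps)
qed

context height_profile
begin

lemma height_profile_move_right:
  assumes "x \<in> V" "h (s x) < h x"
  shows "height_profile V s p (move h x (s x)) (W(x := W x - 1))"
proof
  fix z assume z: "z \<in> V"
  have "p z = x \<longleftrightarrow> z = s x" using z assms by auto
  then show "(W(x := W x - 1)) z = (W(x := W x - 1)) (p z) + int (move h x (s x) z) - 1"
    using W_step[OF z] s_neq[OF assms(1)] s_neq[OF p_in[OF assms(1)]] assms
    by (auto simp: move_def of_nat_diff)
qed (auto simp: finite_V s_in p_in s_neq)

lemma height_profile_move_left:
  assumes "x \<in> V" "h (p x) < h x"
  shows "height_profile V s p (move h x (p x)) (W(p x := W (p x) + 1))"
proof
  fix z assume z: "z \<in> V"
  have "p z = p x \<longleftrightarrow> z = x" using z assms s_p by metis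
  moreover have "p x \<noteq> x" using s_neq[OF p_in[OF assms(1)]] assms by auto
  moreover have "p (p x) \<noteq> p x" using s_neq[OF p_in[OF p_in[OF assms(1)]]] assms by (auto simp: p_in)
  ultimately show "(W(p x := W (p x) + 1)) z = (W(p x := W (p x) + 1)) (p z) + int (move h x (p x) z) - 1"
    using W_step[OF z] assms by (auto simp: move_def of_nat_diff)
qed (auto simp: finite_V s_in p_in s_neq)

lemma pile_energy_move_right:
  assumes "x \<in> V" "h (s x) < h x"
  shows "pile_energy V (move h x (s x)) (W(x := W x - 1))
    = pile_energy V h W - 2 * c (W x) - 2 - 12 * real (card V) * real (h x - h (s x) - 1)"
  unfolding pile_energy_def
    sum_squares_move[of V x "s x" h, OF finite_V assms(1) s_in[OF assms(1)] assms(2)]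
    pair_gap_lower[of V x W, OF finite_V assms(1)]
  by (simp add: algebra_simps)

lemma pile_energy_move_left:
  assumes "x \<in> V" "h (p x) < h x"
  shows "pile_energy V (move h x (p x)) (W(p x := W (p x) + 1))
    = pile_energy V h W + 2 * c (W (p x) + 1) - 2 - 12 * real (card V) * real (h x - h (p x) - 1)"
  unfolding pile_energy_def
    sum_squares_move[of V x "p x" h, OF finite_V assms(1) p_in[OF assms(1)] assms(2)]
    pair_gap_raise[of V "p x" W, OF finite_V p_in[OF assms(1)]]
  by (simp add: algebra_simps)

end

text \<open>Every vertex has its predecessor and its successor as its two distinct neighbors, so that cycles
  have at least three vertices.\<close>

locale ring_pile = height_profile V s p h W
  for V :: "'v set" and s p h W +
  fixes adj :: "'v \<Rightarrow> 'v \<Rightarrow> bool"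
  assumes nbrs_eq: "x \<in> V \<Longrightarrow> nbrs V adj x = {p x, s x}"
    and p_neq_s: "x \<in> V \<Longrightarrow> p x \<noteq> s x"
begin

lemma free_verts_eq: "free_verts V adj h = {x\<in>V. h (p x) < h x \<or> h (s x) < h x}"
  by (auto simp: free_verts_def nbrs_eq)

lemma sum_min_nbrs:
  fixes g :: "'v \<Rightarrow> real"
  assumes "x \<in> free_verts V adj h"
  shows "(\<Sum>y\<in>min_nbrs V adj h x. 1 / real (card (min_nbrs V adj h x)) * g y)
    = right_prob x * g (s x) + left_prob x * g (p x)"
proof -
  have x: "x \<in> V" and free: "h (p x) < h x \<or> h (s x) < h x"
    using assms by (auto simp: free_verts_eq)
  have M: "min_nbrs V adj h x = {y\<in>{p x, s x}. h y = min (h (p x)) (h (s x))}"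
    using x by (simp add: min_nbrs_def nbrs_eq)
  consider "h (p x) < h (s x)" | "h (s x) < h (p x)" | "h (p x) = h (s x)" by linarith
  then show ?thesis
  proof cases
    case 1
    then have "min_nbrs V adj h x = {p x}" unfolding M by auto
    then show ?thesis using 1 free by (auto simp: right_prob_def left_prob_def)
  next
    case 2
    then have "min_nbrs V adj h x = {s x}" unfolding M by auto
    then show ?thesis using 2 free by (auto simp: right_prob_def left_prob_def)
  next
    case 3
    then have "min_nbrs V adj h x = {p x, s x}" unfolding M by auto
    then show ?thesis using 3 free p_neq_s[OF x] by (auto simp: right_prob_def left_prob_def)
  qed
qed

text \<open>The energy is passed as a function \<open>en\<close> of the state alone: the height function after a jump depends on the
  jump, but any height function of the new state gives the same energy.\<close>

theorem energy_drift:
  assumes free: "free_verts V adj h \<noteq> {}"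
    and en: "\<And>h' W'. height_profile V s p h' W' \<Longrightarrow> en h' = pile_energy V h' W'"
  shows "(\<Sum>x\<in>free_verts V adj h. \<Sum>y\<in>min_nbrs V adj h x.
      real (h x) / real (free_mass V adj h) * (1 / real (card (min_nbrs V adj h x))) * en (move h x y))
    \<le> en h - 2"
proof -
  let ?F = "free_verts V adj h" and ?M = "min_nbrs V adj h" and ?n = "real (card V)"
  define S where "S = real (free_mass V adj h)"
  define J where "J x = left_prob x * c (W (p x) + 1) - right_prob x * c (W x)" for x
  have S_eq: "S = (\<Sum>x\<in>?F. real (h x))"
    by (simp add: S_def free_mass_def)
  have finF: "finite ?F" and FV: "?F \<subseteq> V" using finite_V by (auto simp: free_verts_def)
  have S: "S > 0"
  proof -
    obtain x where "x \<in> ?F" using free by auto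
    then show ?thesis unfolding S_eq using finF
      by (intro sum_pos2[of _ x]) (auto simp: free_verts_eq)
  qed
  \<comment> \<open>The expected energy after a jump from \<open>x\<close>: the term \<open>- 2\<close> is the concavity of the pair gap.\<close>
  have local: "(\<Sum>y\<in>?M x. 1 / real (card (?M x)) * en (move h x y))
      = en h - 2 + 2 * J x - 12 * ?n * excess_drop x" if x: "x \<in> ?F" for x
  proof -
    have xV: "x \<in> V" using x FV by auto
    have en0: "en h = pile_energy V h W"
      by (intro en height_profile_axioms)
    have r: "right_prob x * en (move h x (s x))
        = right_prob x * (en h - 2 * c (W x) - 2 - 12 * ?n * excess_drop x)"
    proof (cases "right_prob x = 0")
      case False
      then have "h (s x) < h x" "h (s x) \<le> h (p x)"
        by (auto simp: right_prob_def split: if_splits)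
      then show ?thesis
        using en[OF height_profile_move_right[OF xV]] pile_energy_move_right[OF xV] en0
        by (simp add: excess_drop_def min_def)
    qed simp
    have l: "left_prob x * en (move h x (p x))
        = left_prob x * (en h + 2 * c (W (p x) + 1) - 2 - 12 * ?n * excess_drop x)"
    proof (cases "left_prob x = 0")
      case False
      then have "h (p x) < h x" "h (p x) \<le> h (s x)"
        by (auto simp: left_prob_def split: if_splits)
      then show ?thesis
        using en[OF height_profile_move_left[OF xV]] pile_energy_move_left[OF xV] en0
        by (simp add: excess_drop_def min_def)
    qed simp
    have total: "right_prob x = 1 - left_prob x"
      using x by (auto simp: free_verts_eq right_prob_def left_prob_def)
    show ?thesis
      unfolding sum_min_nbrs[OF x] r l J_def unfolding total by (simp add: algebra_simps)
  qed
  have "(\<Sum>x\<in>?F. \<Sum>y\<in>?M x. real (h x) / S * (1 / real (card (?M x))) * en (move h x y))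
      = (\<Sum>x\<in>?F. real (h x) / S * (\<Sum>y\<in>?M x. 1 / real (card (?M x)) * en (move h x y)))"
    by (simp add: sum_distrib_left mult.assoc)
  also have "\<dots> = (\<Sum>x\<in>?F. real (h x) / S * (en h - 2 + 2 * J x - 12 * ?n * excess_drop x))"
    by (intro sum.cong refl arg_cong2[where f="(*)"] local)
  also have "\<dots> = (\<Sum>x\<in>?F. (en h - 2) * real (h x)
      + 2 * (real (h x) * J x) - 12 * ?n * (real (h x) * excess_drop x)) / S"
    unfolding sum_divide_distrib by (intro sum.cong) (auto simp: field_simps)
  also have "\<dots> = ((en h - 2) * S + 2 * (\<Sum>x\<in>?F. real (h x) * J x)
      - 12 * ?n * (\<Sum>x\<in>?F. real (h x) * excess_drop x)) / S"
    by (simp add: sum.distrib sum_subtractf sum_distrib_left S_eq)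
  also have "(\<Sum>x\<in>?F. real (h x) * J x) = (\<Sum>x\<in>V. real (h x) * J x)"
    using finite_V FV
    by (intro sum.mono_neutral_left) (auto simp: J_def free_verts_eq left_prob_def right_prob_def)
  also have "(\<Sum>x\<in>?F. real (h x) * excess_drop x) = (\<Sum>x\<in>V. real (h x) * excess_drop x)"
    using finite_V FV
    by (intro sum.mono_neutral_left) (auto simp: free_verts_eq excess_drop_def)
  also have "((en h - 2) * S + 2 * (\<Sum>x\<in>V. real (h x) * J x)
      - 12 * ?n * (\<Sum>x\<in>V. real (h x) * excess_drop x)) / S \<le> ((en h - 2) * S) / S"
    using sum_current_le S unfolding J_def by (intro divide_right_mono) auto
  also have "\<dots> = en h - 2" using S by simp
  finally show ?thesis by (simp add: S_def)
qed

end

lemma nn_integral_pile_step: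
  assumes "finite V" and "free_verts V adj \<eta> \<noteq> {}"
  shows "(\<integral>\<^sup>+\<zeta>. g \<zeta> \<partial>pile_step V adj \<eta>)
    = (\<Sum>x\<in>free_verts V adj \<eta>. \<Sum>y\<in>min_nbrs V adj \<eta> x.
        ennreal (real (\<eta> x) / real (free_mass V adj \<eta>) * (1 / real (card (min_nbrs V adj \<eta> x))))
        * g (move \<eta> x y))"
proof -
  let ?F = "free_verts V adj \<eta>" and ?M = "min_nbrs V adj \<eta>"
  define w where "w x = real (\<eta> x) / real (free_mass V adj \<eta>) * (1 / real (card (?M x)))" for x
  have w: "w x \<ge> 0" for x by (simp add: w_def)
  have "ennreal (pile_prob V adj \<eta> \<zeta>)
      = (\<Sum>x\<in>?F. \<Sum>y\<in>?M x. ennreal (w x) * indicator {move \<eta> x y} \<zeta>)" for \<zeta>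
  proof -
    have "pile_prob V adj \<eta> \<zeta> = (\<Sum>x\<in>?F. \<Sum>y\<in>?M x. w x * indicator {move \<eta> x y} \<zeta>)"
      unfolding pile_prob_def w_def using assms(2)
      by (auto intro!: sum.cong split: if_splits split_indicator)
    then show ?thesis
      using w by (simp add: sum_nonneg ennreal_mult ennreal_indicator flip: sum_ennreal)
  qed
  then have "(\<integral>\<^sup>+\<zeta>. g \<zeta> \<partial>pile_step V adj \<eta>)
      = (\<integral>\<^sup>+\<zeta>. (\<Sum>x\<in>?F. \<Sum>y\<in>?M x. ennreal (w x) * (g \<zeta> * indicator {move \<eta> x y} \<zeta>)) \<partial>count_space UNIV)"
    unfolding nn_integral_measure_pmf pmf_pile_step[OF assms(1)]
    by (simp add: sum_distrib_left mult_ac)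
  also have "\<dots> = (\<Sum>x\<in>?F. \<Sum>y\<in>?M x. ennreal (w x) * g (move \<eta> x y))"
    by (simp add: nn_integral_sum nn_integral_cmult)
  finally show ?thesis by (simp add: w_def)
qed

lemma min_nbr_lower:
  assumes "finite V" "x \<in> free_verts V adj \<eta>" "y \<in> min_nbrs V adj \<eta> x"
  shows "y \<in> V" "\<eta> y < \<eta> x"
proof -
  obtain z where z: "z \<in> nbrs V adj x" "\<eta> z < \<eta> x"
    using assms by (auto simp: free_verts_def)
  have "finite (nbrs V adj x)" using assms by (simp add: nbrs_def)
  then have "Min (\<eta> ` nbrs V adj x) \<le> \<eta> z" using z by simp
  then show "\<eta> y < \<eta> x" using assms(3) z by (simp add: min_nbrs_def)
  show "y \<in> V" using assms(3) by (simp add: min_nbrs_def nbrs_def)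
qed

section \<open>The cycle with as many particles as vertices\<close>

definition cycle_succ :: "nat \<Rightarrow> nat \<Rightarrow> nat" where
  "cycle_succ n x = (if Suc x = n then 0 else Suc x)"

definition cycle_pred :: "nat \<Rightarrow> nat \<Rightarrow> nat" where
  "cycle_pred n x = (if x = 0 then n - 1 else x - 1)"

lemma nbrs_cycle:
  assumes "n \<ge> 3" "x < n"
  shows "nbrs (cycle_verts n) (cycle_adj n) x = {cycle_pred n x, cycle_succ n x}"
proof -
  have m: "Suc u mod n = cycle_succ n u" if "u < n" for u
    using that by (auto simp: cycle_succ_def)
  have "nbrs (cycle_verts n) (cycle_adj n) x = {y. y < n \<and> (y = cycle_succ n x \<or> x = cycle_succ n y)}"
    using assms by (auto simp: nbrs_def cycle_verts_def cycle_adj_def m)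
  also have "\<dots> = {cycle_pred n x, cycle_succ n x}"
    using assms by (auto simp: cycle_succ_def cycle_pred_def split: if_splits)
  finally show ?thesis .
qed

definition profile :: "(nat \<Rightarrow> nat) \<Rightarrow> nat \<Rightarrow> int" where
  "profile \<eta> x = (\<Sum>i\<le>x. int (\<eta> i) - 1)"

lemma height_profile_cycle:
  assumes "n \<ge> 3" "(\<Sum>v<n. \<eta> v) = n"
  shows "height_profile (cycle_verts n) (cycle_succ n) (cycle_pred n) \<eta> (profile \<eta>)"
proof
  fix x assume "x \<in> cycle_verts n"
  then have x: "x < n" by (simp add: cycle_verts_def)
  show "profile \<eta> x = profile \<eta> (cycle_pred n x) + int (\<eta> x) - 1"
  proof (cases x)
    case 0
    have "{..n - 1} = {..<n}" using assms(1) by auto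
    then have "profile \<eta> (n - 1) = int (\<Sum>v<n. \<eta> v) - int n"
      by (simp add: profile_def sum_subtractf)
    then show ?thesis using 0 assms(2) by (simp add: profile_def cycle_pred_def)
  next
    case (Suc y)
    then show ?thesis by (simp add: profile_def cycle_pred_def)
  qed
qed (use assms(1) in \<open>auto simp: cycle_verts_def cycle_succ_def cycle_pred_def\<close>)

text \<open>On a single cycle, two height functions of the same state differ by a constant. The partial sums
  \<^const>\<open>profile\<close> have a base point, and a jump between the vertices \<open>n - 1\<close> and \<open>0\<close> changes almost all of
  them; this lemma replaces them after the jump by a height function that changed at one vertex only.\<close>

lemma pair_gap_cycle_unique:
  assumes "height_profile (cycle_verts n) (cycle_succ n) (cycle_pred n) \<eta> W"
  shows "pair_gap (cycle_verts n) W = pair_gap (cycle_verts n) (profile \<eta>)"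
proof -
  have step: "W (Suc x) = W x + int (\<eta> (Suc x)) - 1" if "Suc x < n" for x
    using height_profile.W_step[OF assms, of "Suc x"] that
    by (simp add: cycle_verts_def cycle_pred_def)
  have "x < n \<Longrightarrow> W x = W 0 - profile \<eta> 0 + profile \<eta> x" for x
    by (induction x) (auto simp: step profile_def)
  then have "W x - W y = profile \<eta> x - profile \<eta> y" if "x < n" "y < n" for x y
    using that by (smt (verit))
  then show ?thesis unfolding pair_gap_def cycle_verts_def
    by (intro sum.cong) auto
qed

definition cycle_energy :: "nat \<Rightarrow> (nat \<Rightarrow> nat) \<Rightarrow> real" where
  "cycle_energy n \<eta> = pile_energy (cycle_verts n) \<eta> (profile \<eta>)"

lemma cycle_energy_nonneg: "cycle_energy n \<eta> \<ge> 0"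
  unfolding cycle_energy_def pile_energy_def pair_gap_def
  by (intro add_nonneg_nonneg mult_nonneg_nonneg sum_nonneg) auto

lemma ring_pile_cycle:
  assumes "n \<ge> 3" "(\<Sum>v<n. \<eta> v) = n"
  shows "ring_pile (cycle_verts n) (cycle_succ n) (cycle_pred n) \<eta> (profile \<eta>) (cycle_adj n)"
proof -
  interpret height_profile "cycle_verts n" "cycle_succ n" "cycle_pred n" \<eta> "profile \<eta>"
    using assms by (rule height_profile_cycle)
  show ?thesis
  proof
    fix x assume "x \<in> cycle_verts n"
    then have x: "x < n" by (simp add: cycle_verts_def)
    show "nbrs (cycle_verts n) (cycle_adj n) x = {cycle_pred n x, cycle_succ n x}"
      using assms(1) x by (rule nbrs_cycle)
    show "cycle_pred n x \<noteq> cycle_succ n x"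
      using assms(1) x by (auto simp: cycle_succ_def cycle_pred_def)
  qed
qed

lemma flat_if_no_free_verts:
  assumes n: "n \<ge> 3" and mass: "(\<Sum>v<n. \<eta> v) = n"
    and free: "free_verts (cycle_verts n) (cycle_adj n) \<eta> = {}"
  shows "\<forall>v\<in>cycle_verts n. \<eta> v = 1"
proof -
  interpret ring_pile "cycle_verts n" "cycle_succ n" "cycle_pred n" \<eta> "profile \<eta>" "cycle_adj n"
    using n mass by (rule ring_pile_cycle)
  have flat: "\<eta> x \<le> \<eta> (cycle_succ n x) \<and> \<eta> x \<le> \<eta> (cycle_pred n x)" if "x < n" for x
  proof -
    have "x \<in> cycle_verts n" using that by (simp add: cycle_verts_def)
    then show ?thesis using free by (auto simp: free_verts_eq not_less)
  qed
  have step: "\<eta> (Suc x) = \<eta> x" if "Suc x < n" for x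
    using flat[of x] flat[of "Suc x"] that by (simp add: cycle_succ_def cycle_pred_def)
  have const: "x < n \<Longrightarrow> \<eta> x = \<eta> 0" for x
    by (induction x) (auto simp: step)
  have "(\<Sum>v<n. \<eta> v) = (\<Sum>v<n. \<eta> 0)"
    by (intro sum.cong refl const) simp
  then have "\<eta> 0 = 1" using mass n by simp
  then show ?thesis using const unfolding cycle_verts_def by (metis lessThan_iff)
qed

text \<open>The value \<open>\<infinity>\<close> confines the drift condition to states with \<open>n\<close> particles.\<close>

definition cycle_potential :: "nat \<Rightarrow> (nat \<Rightarrow> nat) \<Rightarrow> ennreal" where
  "cycle_potential n \<eta> = (if (\<Sum>v<n. \<eta> v) = n then ennreal (cycle_energy n \<eta>) else \<infinity>)"

lemma cycle_potential_drift:
  assumes n: "n \<ge> 3" and not_flat: "\<not> (\<forall>v\<in>cycle_verts n. \<eta> v = 1)"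
  shows "(\<integral>\<^sup>+\<zeta>. cycle_potential n \<zeta> \<partial>pile_step (cycle_verts n) (cycle_adj n) \<eta>) + 1
    \<le> cycle_potential n \<eta>"
proof (cases "(\<Sum>v<n. \<eta> v) = n")
  case False
  then show ?thesis by (simp add: cycle_potential_def)
next
  case mass: True
  let ?V = "cycle_verts n" and ?adj = "cycle_adj n"
  interpret ring_pile ?V "cycle_succ n" "cycle_pred n" \<eta> "profile \<eta>" ?adj
    using n mass by (rule ring_pile_cycle)
  have free: "free_verts ?V ?adj \<eta> \<noteq> {}"
    using flat_if_no_free_verts[OF n mass] not_flat by auto
  define w where "w x = real (\<eta> x) / real (free_mass ?V ?adj \<eta>)
    * (1 / real (card (min_nbrs ?V ?adj \<eta> x)))" for x
  let ?D = "\<Sum>x\<in>free_verts ?V ?adj \<eta>. \<Sum>y\<in>min_nbrs ?V ?adj \<eta> x. w x * cycle_energy n (move \<eta> x y)"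
  have pot: "cycle_potential n (move \<eta> x y) = ennreal (cycle_energy n (move \<eta> x y))"
    if "x \<in> free_verts ?V ?adj \<eta>" "y \<in> min_nbrs ?V ?adj \<eta> x" for x y
  proof -
    have "x \<in> ?V" using that by (simp add: free_verts_def)
    then have "(\<Sum>v\<in>?V. move \<eta> x y v) = (\<Sum>v\<in>?V. \<eta> v)"
      using min_nbr_lower[OF finite_V that] finite_V by (intro sum_move)
    then show ?thesis using mass by (simp add: cycle_potential_def cycle_verts_def)
  qed
  have w: "w x \<ge> 0" for x by (simp add: w_def)
  have D: "?D \<le> cycle_energy n \<eta> - 2"
    unfolding w_def
  proof (rule energy_drift[OF free])
    show "cycle_energy n h' = pile_energy ?V h' W'"
      if "height_profile ?V (cycle_succ n) (cycle_pred n) h' W'" for h' W'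
      using pair_gap_cycle_unique[OF that] by (simp add: cycle_energy_def pile_energy_def)
  qed
  have D0: "?D \<ge> 0"
    using w by (intro sum_nonneg mult_nonneg_nonneg cycle_energy_nonneg)
  have "(\<integral>\<^sup>+\<zeta>. cycle_potential n \<zeta> \<partial>pile_step ?V ?adj \<eta>)
      = (\<Sum>x\<in>free_verts ?V ?adj \<eta>. \<Sum>y\<in>min_nbrs ?V ?adj \<eta> x.
          ennreal (w x * cycle_energy n (move \<eta> x y)))"
    unfolding nn_integral_pile_step[OF finite_V free] w_def[symmetric]
    using w by (intro sum.cong) (auto simp: pot ennreal_mult cycle_energy_nonneg)
  also have "\<dots> = ennreal ?D"
    using w by (simp add: sum_ennreal sum_nonneg cycle_energy_nonneg)
  finally have "(\<integral>\<^sup>+\<zeta>. cycle_potential n \<zeta> \<partial>pile_step ?V ?adj \<eta>) + 1 = ennreal (?D + 1)"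
    using D0 by (simp add: ennreal_plus flip: ennreal_1)
  also have "\<dots> \<le> ennreal (cycle_energy n \<eta>)"
    using D by (intro ennreal_leI) simp
  finally show ?thesis using mass by (simp add: cycle_potential_def)
qed

text \<open>Both parts of the energy are of order \<open>n^3\<close> at the start: the height function has oscillation at
  most \<open>n\<close> on \<open>n^2\<close> pairs, and the sum of squares \<open>n^2\<close> has the factor \<open>6 n\<close>.\<close>

lemma cycle_potential_pile_at:
  assumes r: "r < n"
  shows "cycle_potential n (pile_at n r) \<le> ennreal (7 * real n ^ 3)"
proof -
  have mass: "(\<Sum>v<n. pile_at n r v) = n"
    unfolding pile_at_def using r by (subst sum.delta) auto
  have prof: "profile (pile_at n r) x = (if r \<le> x then int n else 0) - int (Suc x)" for x
  proof -
    have "(\<Sum>i\<le>x. int (pile_at n r i)) = (\<Sum>i\<le>x. if i = r then int n else 0)"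
      by (intro sum.cong) (auto simp: pile_at_def)
    also have "\<dots> = (if r \<le> x then int n else 0)"
      by (subst sum.delta) auto
    finally show ?thesis by (simp add: profile_def sum_subtractf)
  qed
  have gap: "\<bar>real_of_int (profile (pile_at n r) x - profile (pile_at n r) y)\<bar> \<le> real n"
    if "x < n" "y < n" for x y
    using that by (auto simp: prof)
  have "pair_gap (cycle_verts n) (profile (pile_at n r)) \<le> (\<Sum>x<n. \<Sum>y<n. real n)"
    unfolding pair_gap_def cycle_verts_def by (intro sum_mono gap) auto
  moreover have "(\<Sum>v<n. (real (pile_at n r v))\<^sup>2) = (real n)\<^sup>2"
  proof -
    have "(\<Sum>v<n. (real (pile_at n r v))\<^sup>2) = (\<Sum>v<n. if v = r then (real n)\<^sup>2 else 0)"
      by (intro sum.cong) (auto simp: pile_at_def)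
    also have "\<dots> = (real n)\<^sup>2"
      using r by (subst sum.delta) auto
    finally show ?thesis .
  qed
  ultimately have "cycle_energy n (pile_at n r) \<le> 7 * real n ^ 3"
    by (simp add: cycle_energy_def pile_energy_def cycle_verts_def power2_eq_square power3_eq_cube)
  then show ?thesis using mass by (simp add: cycle_potential_def ennreal_leI)
qed

theorem theorem4p2:
  shows "\<exists>C::real. \<forall>n::nat. n \<ge> 3 \<longrightarrow> (\<forall>r \<in> cycle_verts n.
           (\<integral>\<^sup>+\<omega>. ennreal_of_enat (flat_time (cycle_verts n) \<omega>)
              \<partial>pile_process (cycle_verts n) (cycle_adj n) (pile_at n r))
           \<le> ennreal (C * real n ^ 3))"
proof (intro exI allI impI ballI)
  fix n r :: nat assume n: "n \<ge> 3" and r: "r \<in> cycle_verts n"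
  have "(\<integral>\<^sup>+\<omega>. ennreal_of_enat (flat_time (cycle_verts n) \<omega>)
        \<partial>pile_process (cycle_verts n) (cycle_adj n) (pile_at n r))
      \<le> cycle_potential n (pile_at n r)"
    unfolding flat_time_def pile_process_def
    by (intro expected_hitting_time_le_Lyapunov cycle_potential_drift n) simp
  also have "\<dots> \<le> ennreal (7 * real n ^ 3)"
    using r by (intro cycle_potential_pile_at) (simp add: cycle_verts_def)
  finally show "(\<integral>\<^sup>+\<omega>. ennreal_of_enat (flat_time (cycle_verts n) \<omega>)
        \<partial>pile_process (cycle_verts n) (cycle_adj n) (pile_at n r)) \<le> ennreal (7 * real n ^ 3)" .
qed

end
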